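(* Let $S\neq\mathbb Z_{\ge 0}$ be a numerical semigroup, let $m\in S$ be nonzero, and let $c_1<\dots<c_n$ be the elements of $\mathbb Z_{\ge 0}\setminus S$. Let $f$ be an arbitrary function on $\mathbb Z_{\ge 0}$ with values in a commutative ring with unity, and let $p$ be an integer with $0<p\le m$. Then for every integer $k\ge 1$ $$\sum_{i=1}^n\bigl(f(c_i+m)-f(c_i)\bigr)\Bigl(\sum_{J\subset T_i,\ |J|=p-1}h_{k-1}(f\{J\},f(c_i),f(c_i+m))\Bigr)=\sum_{I\subset S^{(m)},\ |I|=p}h_k(f\{I\})-\sum_{I\subset I_m,\ |I|=p}h_k(f\{I\}).$$ In particular, for $p=m$, $$\sum_{i=1}^n\bigl(f(c_i+m)-f(c_i)\bigr)h_{k-1}(f\{T_i\},f(c_i),f(c_i+m))=h_k(f\{S^{(m)}\})-h_k(f\{I_m\}),$$ and for $p=m$, $k=1$ this reads $$\sum_{c\in\mathbb Z_{\ge 0}\setminus S}\bigl(f(c+m)-f(c)\bigr)=\sum_{a\in S^{(m)}}f(a)-\sum_{i=0}^{m-1}f(i).$$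
   Context: A numerical semigroup is a set $S\subset\mathbb Z_{\ge 0}$ that contains $0$, is closed under addition and has finite complement in $\mathbb Z_{\ge 0}$. For a numerical semigroup $S$ and a nonzero $m\in S$, the Apéry set is $S^{(m)}:=\{s\in S: s-m\notin S\}$; it has exactly $m$ elements, one in each residue class mod $m$, and contains $0$. Put $I_m:=\{0,1,\dots,m-1\}$. With $\mathbb Z_{\ge 0}\setminus S=\{c_1<\dots<c_n\}$, let $S_0:=\mathbb Z_{\ge 0}$ and $S_i:=\mathbb Z_{\ge 0}\setminus\{c_1,\dots,c_i\}$ for $i=1,\dots,n$ (so $S_n=S$); each $S_i$ is a numerical semigroup containing $m$. For $i=1,\dots,n$ put $T_i:=S_i^{(m)}\setminus\{c_i+m\}=S_{i-1}^{(m)}\setminus\{c_i\}$, a set of $m-1$ elements. For a finite set $A\subset\mathbb Z_{\ge 0}$, $f\{A\}$ denotes the family $(f(a))_{a\in A}$ of $|A|$ values counted with multiplicity, in any order; $(f\{J\},u,v)$ denotes this family with the two further entries $u,v$ appended. The complete symmetric functions are $h_k(x_1,\dots,x_r):=\sum_{i_1\le\dots\le i_k}x_{i_1}\cdots x_{i_k}$, with $h_0=1$. *)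

theory Defs
  imports Main
begin

definition numerical_semigroup :: "nat set \<Rightarrow> bool" where
  "numerical_semigroup S \<longleftrightarrow>
     0 \<in> S \<and> (\<forall>a\<in>S. \<forall>b\<in>S. a + b \<in> S) \<and> finite (UNIV - S)"

(* The difference s - m is taken in the integers: for s < m it is negative, hence not in S. *)
definition apery :: "nat set \<Rightarrow> nat \<Rightarrow> nat set" where
  "apery S m = {s \<in> S. int s - int m \<notin> int ` S}"

(* Here c 1 < ... < c n are meant to be the gaps of a numerical semigroup (indexing from 1);
   then gap_trunc c 0 = UNIV and gap_trunc c n is the semigroup itself. *)
definition gap_trunc :: "(nat \<Rightarrow> nat) \<Rightarrow> nat \<Rightarrow> nat set" where
  "gap_trunc c i = UNIV - c ` {1..i}"

definition apery_core :: "nat \<Rightarrow> (nat \<Rightarrow> nat) \<Rightarrow> nat \<Rightarrow> nat set" where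
  "apery_core m c i = apery (gap_trunc c i) m - {c i + m}"

(* The values of f on a finite set, with multiplicity; they are listed by increasing argument,
   but the order is immaterial, as families only occur as arguments of complete_sym. *)
definition family :: "(nat \<Rightarrow> 'a) \<Rightarrow> nat set \<Rightarrow> 'a list" where
  "family f A = map f (sorted_list_of_set A)"

(* A list js stands for the index sequence i_1 \<le> ... \<le> i_k (indexing from 0).
   The sort is that of commutative rings with unity in which 0 = 1 is not excluded,
   unlike in comm_ring_1. *)
definition complete_sym :: "nat \<Rightarrow> 'a::{comm_ring,comm_monoid_mult} list \<Rightarrow> 'a" where
  "complete_sym k xs =
     (\<Sum>js | length js = k \<and> sorted js \<and> set js \<subseteq> {..<length xs}. \<Prod>j\<leftarrow>js. xs ! j)"

end

theory Submission
  imports Defs "HOL-Library.Multiset"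
begin

text \<open>
  Passing from \<open>S\<^bsub>i-1\<^esub>\<close> to \<open>S\<^sub>i\<close> replaces the element \<open>c\<^sub>i\<close> of the Apery set by \<open>c\<^sub>i + m\<close> and
  keeps the other elements, which form \<open>T\<^sub>i\<close>. The subsets that avoid the exchanged element contribute
  equally before and after, and for the others
  \<open>h\<^sub>k(u, x) - h\<^sub>k(v, x) = (u - v) h\<^bsub>k-1\<^esub>(u, v, x)\<close>. Hence the \<open>i\<close>-th summand is the change of
  \<open>\<Sum>\<^sub>I h\<^sub>k(f{I})\<close> at the \<open>i\<close>-th step, and the sum telescopes.
\<close>

section \<open>Complete symmetric functions\<close>

lemma complete_sym_0 [simp]: "complete_sym 0 xs = 1"
proof -
  have "{js :: nat list. length js = 0 \<and> sorted js \<and> set js \<subseteq> {..<length xs}} = {[]}"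
    by auto
  then show ?thesis
    unfolding complete_sym_def by simp
qed

lemma complete_sym_Suc_Nil [simp]: "complete_sym (Suc k) [] = 0"
proof -
  have no: "{js :: nat list. length js = Suc k \<and> sorted js \<and> set js \<subseteq> {..<0}} = {}"
    by auto
  show ?thesis
    unfolding complete_sym_def list.size no by simp
qed

text \<open>A sorted list containing the index 0 starts with it; any other is the shift of a list
  over one index fewer.\<close>

lemma sorted_lists_Suc_Suc:
  "{js. length js = Suc k \<and> sorted js \<and> set js \<subseteq> {..<Suc n}} =
    (#) 0 ` {js. length js = k \<and> sorted js \<and> set js \<subseteq> {..<Suc n}} \<union>
    map Suc ` {js. length js = Suc k \<and> sorted js \<and> set js \<subseteq> {..<n}}"
  (is "?L = ?Z \<union> ?P")
proof (intro equalityI subsetI)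
  fix js assume js: "js \<in> ?L"
  show "js \<in> ?Z \<union> ?P"
  proof (cases "0 \<in> set js")
    case True
    with js obtain js' where "js = 0 # js'"
      by (cases js) auto
    with js show ?thesis by auto
  next
    case False
    then have "js = map Suc (map (\<lambda>j. j - 1) js)"
      by (induction js) auto
    then obtain js' where "js = map Suc js'" ..
    with js have "js \<in> ?P"
      by (auto simp: sorted_map sorted_wrt_map)
    then show ?thesis ..
  qed
next
  fix js assume "js \<in> ?Z \<union> ?P"
  then show "js \<in> ?L"
    by (auto simp: sorted_map sorted_wrt_map)
qed

text \<open>Index lists starting with 0 contribute a factor \<open>x\<close>; the shifted ones see
  only \<open>xs\<close>. All later facts on \<open>complete_sym\<close> rest on this recurrence and
  the two boundary cases.\<close>

lemma complete_sym_Suc_Cons: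
  "complete_sym (Suc k) (x # xs) = x * complete_sym k (x # xs) + complete_sym (Suc k) xs"
proof -
  let ?L = "\<lambda>k n. {js :: nat list. length js = k \<and> sorted js \<and> set js \<subseteq> {..<n}}"
  let ?g = "\<lambda>js. \<Prod>j\<leftarrow>js. (x # xs) ! j"
  let ?n = "length xs"
  have fin: "finite (?L k n)" for k n
    by (rule finite_subset[OF _ finite_lists_length_eq[of "{..<n}" k]]) auto
  have "complete_sym (Suc k) (x # xs)
      = sum ?g ((#) 0 ` ?L k (Suc ?n) \<union> map Suc ` ?L (Suc k) ?n)"
    unfolding complete_sym_def list.size add_Suc_right add_0_right sorted_lists_Suc_Suc ..
  also have "\<dots> = sum ?g ((#) 0 ` ?L k (Suc ?n)) + sum ?g (map Suc ` ?L (Suc k) ?n)"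
    by (intro sum.union_disjoint finite_imageI fin) auto
  also have "sum ?g ((#) 0 ` ?L k (Suc ?n)) = x * complete_sym k (x # xs)"
    by (subst sum.reindex) (auto simp: complete_sym_def sum_distrib_left)
  also have "sum ?g (map Suc ` ?L (Suc k) ?n) = complete_sym (Suc k) xs"
    by (subst sum.reindex) (auto simp: complete_sym_def o_def intro: inj_on_subset[of _ UNIV])
  finally show ?thesis .
qed

text \<open>Induction on \<open>k\<close> by the recurrence; this form makes the case
  \<open>k = 0\<close> trivial. Nothing is divided by \<open>x - y\<close>, so zero divisors do no
  harm.\<close>

lemma diff_times_complete_sym:
  "(x - y) * complete_sym k (x # y # xs) =
    x * complete_sym k (x # xs) - y * complete_sym k (y # xs)"
proof (induction k)
  case (Suc k)
  have "(x - y) * complete_sym (Suc k) (x # y # xs)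
      = x * ((x - y) * complete_sym k (x # y # xs)) + (x - y) * complete_sym (Suc k) (y # xs)"
    by (subst complete_sym_Suc_Cons) (simp add: algebra_simps)
  also have "\<dots> = x * (x * complete_sym k (x # xs)) - x * (y * complete_sym k (y # xs))
      + x * complete_sym (Suc k) (y # xs) - y * complete_sym (Suc k) (y # xs)"
    unfolding Suc.IH by (simp add: algebra_simps)
  also have "\<dots> = x * complete_sym (Suc k) (x # xs) - y * complete_sym (Suc k) (y # xs)"
    by (simp add: complete_sym_Suc_Cons[of k] algebra_simps)
  finally show ?case .
qed simp

text \<open>After one use of the recurrence on each side, the common terms
  \<open>complete_sym (Suc k) xs\<close> cancel.\<close>

lemma complete_sym_diff:
  "complete_sym (Suc k) (x # xs) - complete_sym (Suc k) (y # xs) =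
    (x - y) * complete_sym k (x # y # xs)"
  unfolding diff_times_complete_sym complete_sym_Suc_Cons by simp

text \<open>Sorted index lists hide the symmetry, so it is derived from the recurrence and the
  difference formula.\<close>

lemma complete_sym_swap: "complete_sym k (x # y # xs) = complete_sym k (y # x # xs)"
proof (induction k)
  case (Suc k)
  \<comment> \<open>Writing \<open>x = y + (x - y)\<close> lets the difference formula trade
    \<open>y # xs\<close> for \<open>x # xs\<close> in the last term.\<close>
  have "complete_sym (Suc k) (x # y # xs)
      = y * complete_sym k (x # y # xs) + (x - y) * complete_sym k (x # y # xs)
        + complete_sym (Suc k) (y # xs)"
    by (simp add: complete_sym_Suc_Cons[of k x] algebra_simps)
  also have "\<dots> = y * complete_sym k (x # y # xs) + complete_sym (Suc k) (x # xs)"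
    unfolding complete_sym_diff[symmetric] by simp
  also have "\<dots> = complete_sym (Suc k) (y # x # xs)"
    unfolding Suc.IH complete_sym_Suc_Cons[of k y] ..
  finally show ?case .
qed simp

text \<open>The recurrence sees the tail only through its values in all degrees, hence the
  assumption for every \<open>k\<close>.\<close>

lemma complete_sym_Cons_cong:
  assumes "\<And>k. complete_sym k xs = complete_sym k ys"
  shows "complete_sym k (x # xs) = complete_sym k (x # ys)"
  by (induction k) (simp_all add: complete_sym_Suc_Cons assms)

lemma complete_sym_move: "complete_sym k (xs @ x # ys) = complete_sym k (x # xs @ ys)"
proof (induction xs arbitrary: k)
  case (Cons y xs)
  have "complete_sym k (y # xs @ x # ys) = complete_sym k (y # x # xs @ ys)"
    by (rule complete_sym_Cons_cong) (rule Cons.IH)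
  then show ?case
    by (simp add: complete_sym_swap)
qed simp

text \<open>The head of \<open>xs\<close> is located in \<open>ys\<close>, moved to the front and
  stripped. This makes the listing order in \<open>family\<close> immaterial.\<close>

lemma complete_sym_mset_cong:
  assumes "mset xs = mset ys"
  shows "complete_sym k xs = complete_sym k ys"
  using assms
proof (induction xs arbitrary: ys k)
  case (Cons x xs)
  then have "x \<in> set ys"
    by (metis list.set_intros(1) mset_eq_setD)
  then obtain us vs where ys: "ys = us @ x # vs"
    by (auto simp: in_set_conv_decomp)
  with Cons.prems have "mset xs = mset (us @ vs)"
    by simp
  then have "complete_sym k (x # xs) = complete_sym k (x # us @ vs)"
    by (intro complete_sym_Cons_cong Cons.IH)
  then show ?case
    by (simp add: ys complete_sym_move)
qed simp

lemma complete_sym_1: "complete_sym 1 xs = sum_list xs"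
  by (induction xs) (simp_all add: complete_sym_Suc_Cons)

section \<open>Families of values and sums over subsets of a given size\<close>

lemma mset_family_insert:
  assumes "finite A" and "a \<notin> A"
  shows "mset (family f (insert a A)) = mset (f a # family f A)"
  using assms by (simp add: family_def)

lemma sum_list_family: "finite A \<Longrightarrow> sum_list (family f A) = sum f A"
  by (simp add: family_def sum_list_distinct_conv_sum_set)

lemma sum_subsets_insert:
  fixes g :: "'b set \<Rightarrow> 'a::comm_monoid_add"
  assumes "finite T" and "a \<notin> T"
  shows "(\<Sum>I | I \<subseteq> insert a T \<and> card I = Suc q. g I) =
    (\<Sum>I | I \<subseteq> T \<and> card I = Suc q. g I) + (\<Sum>J | J \<subseteq> T \<and> card J = q. g (insert a J))"
proof -
  let ?P = "\<lambda>q. {I. I \<subseteq> T \<and> card I = q}"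
  have fin: "finite (?P q)" for q
    using assms(1) by auto
  have card_insert: "card (insert a J) = Suc (card J)" if "J \<subseteq> T" for J
    using that assms by (meson card_insert_disjoint finite_subset subsetD)
  have split: "{I. I \<subseteq> insert a T \<and> card I = Suc q} = ?P (Suc q) \<union> insert a ` ?P q"
  proof (intro equalityI subsetI)
    fix I assume I: "I \<in> {I. I \<subseteq> insert a T \<and> card I = Suc q}"
    show "I \<in> ?P (Suc q) \<union> insert a ` ?P q"
    proof (cases "a \<in> I")
      case True
      then have "I = insert a (I - {a})" "I - {a} \<subseteq> T"
        using I by auto
      moreover have "card (I - {a}) = q"
        using I card_insert[OF \<open>I - {a} \<subseteq> T\<close>] \<open>I = insert a (I - {a})\<close> by auto
      ultimately show ?thesis by blast
    qed (use I in auto)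
  qed (auto simp: card_insert)
  have "inj_on (insert a) (?P q)"
    using assms(2) by (auto simp: inj_on_def)
  moreover have "?P (Suc q) \<inter> insert a ` ?P q = {}"
    using assms(2) by auto
  ultimately show ?thesis
    unfolding split by (simp add: sum.union_disjoint fin sum.reindex)
qed

text \<open>One exchange step, later used with \<open>T\<close> the core and \<open>a\<close>,
  \<open>b\<close> the gap and its translate by \<open>m\<close>. Subsets of \<open>T\<close>
  cancel; \<open>insert b J\<close> is paired with \<open>insert a J\<close>.\<close>

lemma sum_complete_sym_exchange:
  assumes "finite T" and "a \<notin> T" and "b \<notin> T"
  shows "(\<Sum>I | I \<subseteq> insert b T \<and> card I = Suc q. complete_sym (Suc k) (family f I))
      - (\<Sum>I | I \<subseteq> insert a T \<and> card I = Suc q. complete_sym (Suc k) (family f I))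
    = (f b - f a) * (\<Sum>J | J \<subseteq> T \<and> card J = q. complete_sym k (family f J @ [f a, f b]))"
proof -
  have ins: "complete_sym (Suc k) (family f (insert z J)) = complete_sym (Suc k) (f z # family f J)"
    if "J \<subseteq> T" "z \<notin> T" for z J
    using that assms(1)
    by (intro complete_sym_mset_cong mset_family_insert) (auto intro: finite_subset)
  have "complete_sym (Suc k) (family f (insert b J)) - complete_sym (Suc k) (family f (insert a J))
      = (f b - f a) * complete_sym k (family f J @ [f a, f b])" if "J \<subseteq> T" for J
  proof -
    have "complete_sym k (f b # f a # family f J) = complete_sym k (family f J @ [f a, f b])"
      by (rule complete_sym_mset_cong) simp
    then show ?thesis
      by (simp only: ins[OF that assms(2)] ins[OF that assms(3)] complete_sym_diff)
  qed
  then show ?thesis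
    by (simp add: sum_subsets_insert assms sum_distrib_left flip: sum_subtractf)
qed

section \<open>Apery sets of the truncations\<close>

lemma mem_apery_iff: "s \<in> apery S m \<longleftrightarrow> s \<in> S \<and> (m \<le> s \<longrightarrow> s - m \<notin> S)"
proof (cases "m \<le> s")
  case True
  then have "int s - int m = int (s - m)"
    by simp
  then show ?thesis
    using True unfolding apery_def by (auto simp only: mem_Collect_eq inj_image_mem_iff inj_of_nat)
next
  case False
  then have "int s - int m \<notin> int ` S"
    by auto
  with False show ?thesis
    by (simp add: apery_def)
qed

lemma apery_UNIV: "apery UNIV m = {0..<m}"
  by (auto simp: mem_apery_iff)

text \<open>Only \<open>d + m\<close> has \<open>d\<close> as its translate by \<open>-m\<close>, so
  it alone enters; it survives the removal of \<open>d\<close> because \<open>m\<close> is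
  nonzero.\<close>

lemma apery_Diff_singleton:
  assumes "d \<in> apery S m" and "d + m \<in> S" and "m \<noteq> 0"
  shows "apery (S - {d}) m = insert (d + m) (apery S m - {d})"
  using assms by (auto simp: mem_apery_iff)

lemma
  assumes S: "numerical_semigroup S" "m \<in> S" "m \<noteq> 0"
    and c: "strict_mono_on {1..n} c" "c ` {1..n} = UNIV - S"
    and i: "Suc i \<le> n"
  shows apery_gap_trunc_eq: "apery (gap_trunc c i) m = insert (c (Suc i)) (apery_core m c (Suc i))"
    and apery_gap_trunc_Suc:
      "apery (gap_trunc c (Suc i)) m = insert (c (Suc i) + m) (apery_core m c (Suc i))"
    and gap_notin_apery_core: "c (Suc i) \<notin> apery_core m c (Suc i)"
proof -
  let ?d = "c (Suc i)"
  have less: "c j < c l" if "1 \<le> j" "j < l" "l \<le> n" for j l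
    using strict_mono_onD[OF c(1), of j l] that by simp
  have trunc_Suc: "gap_trunc c (Suc i) = gap_trunc c i - {?d}"
    unfolding gap_trunc_def by (auto simp: atLeastAtMostSuc_conv)
  \<comment> \<open>The gaps removed so far all lie below \<open>?d\<close>.\<close>
  have above: "x \<in> gap_trunc c i" if "?d \<le> x" for x
  proof -
    have "c j < ?d" if "j \<in> {1..i}" for j
      using less[of j "Suc i"] that i by auto
    with \<open>?d \<le> x\<close> show ?thesis
      by (fastforce simp: gap_trunc_def)
  qed
  \<comment> \<open>Adding \<open>m\<close> to an element of \<open>S\<close> cannot give the gap
    \<open>?d\<close>, so \<open>?d - m\<close> is itself a gap; being smaller than
    \<open>?d\<close>, it was removed earlier.\<close>
  have "?d - m \<notin> gap_trunc c i" if "m \<le> ?d"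
  proof -
    have "?d \<notin> S"
      using c(2) i imageI[of "Suc i" "{1..n}" c] by simp
    moreover have "?d - m + m \<in> S" if "?d - m \<in> S"
      using S that by (simp add: numerical_semigroup_def)
    ultimately have "?d - m \<in> c ` {1..n}"
      unfolding c(2) using that by auto
    then obtain j where j: "1 \<le> j" "j \<le> n" "?d - m = c j"
      by auto
    have "c j < ?d"
      using j(3) that S(3) by linarith
    then have "j \<le> i"
      using less[of "Suc i" j] j by (cases j "Suc i" rule: linorder_cases) auto
    with j show ?thesis
      by (auto simp: gap_trunc_def)
  qed
  then have d: "?d \<in> apery (gap_trunc c i) m"
    by (simp add: mem_apery_iff above)
  have ap: "apery (gap_trunc c (Suc i)) m = insert (?d + m) (apery (gap_trunc c i) m - {?d})"
    unfolding trunc_Suc by (intro apery_Diff_singleton d above S) simp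
  \<comment> \<open>Since \<open>?d\<close> still lies in the old truncation, \<open>?d + m\<close>
    is new. Deleting it again gives the second description of the core, as the old Apery set without
    \<open>?d\<close>.\<close>
  have "?d + m \<notin> apery (gap_trunc c i) m"
    by (simp add: mem_apery_iff above)
  then have core: "apery_core m c (Suc i) = apery (gap_trunc c i) m - {?d}"
    unfolding apery_core_def ap by auto
  show "apery (gap_trunc c i) m = insert ?d (apery_core m c (Suc i))"
    using d by (auto simp: core)
  show "apery (gap_trunc c (Suc i)) m = insert (?d + m) (apery_core m c (Suc i))"
    unfolding ap core ..
  show "?d \<notin> apery_core m c (Suc i)"
    by (simp add: core)
qed

text \<open>The Apery set starts as \<open>{0..<m}\<close>, and each gap exchanges one element for
  another outside the core.\<close>

lemma finite_card_apery_gap_trunc: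
  assumes "numerical_semigroup S" "m \<in> S" "m \<noteq> 0"
    and "strict_mono_on {1..n} c" "c ` {1..n} = UNIV - S"
    and "i \<le> n"
  shows "finite (apery (gap_trunc c i) m) \<and> card (apery (gap_trunc c i) m) = m"
  using \<open>i \<le> n\<close>
proof (induction i)
  case 0
  then show ?case by (simp add: gap_trunc_def apery_UNIV)
next
  case (Suc i)
  have "c (Suc i) + m \<notin> apery_core m c (Suc i)"
    by (simp add: apery_core_def)
  with gap_notin_apery_core[OF assms(1-5) Suc.prems] Suc.IH Suc.prems show ?case
    by (auto simp: apery_gap_trunc_eq[OF assms(1-5) Suc.prems]
        apery_gap_trunc_Suc[OF assms(1-5) Suc.prems])
qed

section \<open>Telescoping over the gaps\<close>

lemma sum_subsets_full_card:
  fixes g :: "'b set \<Rightarrow> 'a::comm_monoid_add"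
  assumes "finite A" and "card A = q"
  shows "(\<Sum>I | I \<subseteq> A \<and> card I = q. g I) = g A"
proof -
  have "{I. I \<subseteq> A \<and> card I = q} = {A}"
    using assms by (auto dest: card_subset_eq)
  then show ?thesis by simp
qed

theorem mainTheorem4:
  fixes S :: "nat set" and m n :: nat and c :: "nat \<Rightarrow> nat"
    and f :: "nat \<Rightarrow> 'a::{comm_ring,comm_monoid_mult}"
  assumes "numerical_semigroup S"
    and "S \<noteq> UNIV"
    and "m \<in> S" and "m \<noteq> 0"
    and "strict_mono_on {1..n} c" and "c ` {1..n} = UNIV - S"
  shows
    "(\<forall>p k. 0 < p \<and> p \<le> m \<and> 1 \<le> k \<longrightarrow>
        (\<Sum>i=1..n. (f (c i + m) - f (c i)) *
           (\<Sum>J | J \<subseteq> apery_core m c i \<and> card J = p - 1.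
              complete_sym (k - 1) (family f J @ [f (c i), f (c i + m)])))
        = (\<Sum>I | I \<subseteq> apery S m \<and> card I = p. complete_sym k (family f I))
          - (\<Sum>I | I \<subseteq> {0..<m} \<and> card I = p. complete_sym k (family f I)))
     \<and> (\<forall>k\<ge>1.
        (\<Sum>i=1..n. (f (c i + m) - f (c i)) *
           complete_sym (k - 1) (family f (apery_core m c i) @ [f (c i), f (c i + m)]))
        = complete_sym k (family f (apery S m)) - complete_sym k (family f {0..<m}))
     \<and> (\<Sum>x\<in>UNIV - S. f (x + m) - f x) = (\<Sum>a\<in>apery S m. f a) - (\<Sum>i=0..<m. f i)"
proof -
  note gaps = assms(1,3-6)
  let ?F = "\<lambda>p k A. \<Sum>I | I \<subseteq> A \<and> card I = p. complete_sym k (family f I)"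
  have trunc_0: "apery (gap_trunc c 0) m = {0..<m}"
    by (simp add: gap_trunc_def apery_UNIV)
  have trunc_n: "gap_trunc c n = S"
    unfolding gap_trunc_def assms(6) by auto
  have core: "finite (apery_core m c (Suc i)) \<and> card (apery_core m c (Suc i)) = m - 1"
    if "Suc i \<le> n" for i
    using finite_card_apery_gap_trunc[OF gaps, of i] gap_notin_apery_core[OF gaps that] that
    by (auto simp: apery_gap_trunc_eq[OF gaps that])
  have finite_S: "finite (apery S m)" and card_S: "card (apery S m) = m"
    using finite_card_apery_gap_trunc[OF gaps order_refl] by (simp_all add: trunc_n)
  have sum_eq: "(\<Sum>i=1..n. (f (c i + m) - f (c i)) *
      (\<Sum>J | J \<subseteq> apery_core m c i \<and> card J = p - 1.
        complete_sym (k - 1) (family f J @ [f (c i), f (c i + m)])))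
      = ?F p k (apery S m) - ?F p k {0..<m}" (is "(\<Sum>i=1..n. ?G i) = _")
    if "0 < p" "1 \<le> k" for p k
  proof -
    \<comment> \<open>The exchange lemma is taken at \<open>k - 1\<close> and \<open>p - 1\<close>;
      positivity of \<open>k\<close> and \<open>p\<close> restores \<open>k\<close> and
      \<open>p\<close> after \<open>Suc\<close>.\<close>
    have step: "?G (Suc i) = ?F p k (apery (gap_trunc c (Suc i)) m) - ?F p k (apery (gap_trunc c i) m)"
      if "Suc i \<le> n" for i
    proof -
      have "c (Suc i) + m \<notin> apery_core m c (Suc i)"
        by (simp add: apery_core_def)
      then show ?thesis
        using sum_complete_sym_exchange[of "apery_core m c (Suc i)" "c (Suc i)" "c (Suc i) + m"
            "k - 1" f "p - 1"] core[OF that] gap_notin_apery_core[OF gaps that] \<open>0 < p\<close> \<open>1 \<le> k\<close>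
        by (simp add: apery_gap_trunc_eq[OF gaps that] apery_gap_trunc_Suc[OF gaps that])
    qed
    have "(\<Sum>i=1..n. ?G i) = (\<Sum>i<n. ?G (Suc i))"
      by (rule sum.reindex_bij_witness[of _ Suc "\<lambda>i. i - 1"]) auto
    also have "\<dots> = (\<Sum>i<n. ?F p k (apery (gap_trunc c (Suc i)) m) - ?F p k (apery (gap_trunc c i) m))"
      by (intro sum.cong refl step) simp
    also have "\<dots> = ?F p k (apery S m) - ?F p k {0..<m}"
      by (subst sum_lessThan_telescope) (simp add: trunc_0 trunc_n)
    finally show ?thesis .
  qed
  have full: "(\<Sum>i=1..n. (f (c i + m) - f (c i)) *
      complete_sym (k - 1) (family f (apery_core m c i) @ [f (c i), f (c i + m)]))
      = complete_sym k (family f (apery S m)) - complete_sym k (family f {0..<m})"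
    if "1 \<le> k" for k
  proof -
    \<comment> \<open>For \<open>p = m\<close> the core has exactly \<open>p - 1\<close> elements,
      so it is the only subset \<open>J\<close>.\<close>
    have "(\<Sum>J | J \<subseteq> apery_core m c i \<and> card J = m - 1.
          complete_sym (k - 1) (family f J @ [f (c i), f (c i + m)]))
        = complete_sym (k - 1) (family f (apery_core m c i) @ [f (c i), f (c i + m)])"
      if "i \<in> {1..n}" for i
      using core[of "i - 1"] that by (intro sum_subsets_full_card) auto
    then show ?thesis
      using sum_eq[of m k] that assms(4)
      by (simp add: sum_subsets_full_card finite_S card_S)
  qed
  have "(\<Sum>x\<in>UNIV - S. f (x + m) - f x) = (\<Sum>i=1..n. f (c i + m) - f (c i))"
    unfolding assms(6)[symmetric]
    by (subst sum.reindex[OF strict_mono_on_imp_inj_on[OF assms(5)]]) simp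
  \<comment> \<open>The case \<open>k = 1\<close>: the factor of degree 0 is 1, and degree 1 gives
    plain sums.\<close>
  also have "\<dots> = (\<Sum>a\<in>apery S m. f a) - (\<Sum>i=0..<m. f i)"
    using full[of 1] by (simp add: complete_sym_1[unfolded One_nat_def] sum_list_family finite_S)
  finally show ?thesis
    using sum_eq full by simp
qed

end
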